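(* Let $\bm{\Theta}$ be a random vector in $\mathbb{R}^K$ with density $f_{\bm{\Theta}}$, let $\bm{G}:\mathbb{R}^K\to\mathbb{C}^{T\times M}$ be differentiable (almost surely on the support of $\bm{\Theta}$), let $\sigma_{\bm{\upsilon}}^2>0$, and let $\bm{J}(\bm{\theta}|\bm{Q})$ be the conditional Fisher information matrix defined in the context. Then the function $$\bm{Q}\mapsto \mathrm{tr}\left(\mathbb{E}\left[\bm{J}(\bm{\Theta}|\bm{Q})^{-1}\right]\right)$$ is monotonically non-increasing (with respect to the positive semi-definite order: $\bm{Q}_1\succeq\bm{Q}_2$ implies that its value at $\bm{Q}_1$ is at most its value at $\bm{Q}_2$) and convex in $\bm{Q}\in\mathbb{S}_+^M$.
   Context: $\mathbb{S}_+^M$ is the cone of $M\times M$ complex Hermitian positive semi-definite matrices, and $\succeq$ is the positive semi-definite (Loewner) order. For $\bm{\theta}\in\mathbb{R}^K$ and $\bm{Q}\in\mathbb{S}_+^M$, $\bm{J}(\bm{\theta}|\bm{Q})$ is the real $K\times K$ matrix with entries $$[\bm{J}(\bm{\theta}|\bm{Q})]_{ij}=\frac{2}{\sigma_{\bm{\upsilon}}^2}\,\mathrm{Re}\left\{\mathrm{tr}\left(\frac{\partial\bm{G}(\bm{\theta})}{\partial\theta_j}\,\bm{Q}\,\frac{\partial\bm{G}(\bm{\theta})^{\mathsf H}}{\partial\theta_i}\right)\right\}.$$ The expectation is over $\bm{\Theta}\sim f_{\bm{\Theta}}$. Convention: the function takes values in $[0,+\infty]$, with value $+\infty$ if $\bm{J}(\bm{\Theta}|\bm{Q})$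 is singular with positive probability; otherwise it is the (possibly infinite) expectation of the non-negative random variable $\mathrm{tr}(\bm{J}(\bm{\Theta}|\bm{Q})^{-1})$. *)

theory Defs
  imports "HOL-Probability.Probability"
begin

definition hermitian_transpose :: "complex^'n^'m \<Rightarrow> complex^'m^'n" where
  "hermitian_transpose A = (\<chi> i j. cnj (A $ j $ i))"

text \<open>For Hermitian \<open>A\<close> the quadratic form below is real, so taking its real part loses nothing.\<close>

definition hermitian_psd :: "complex^'m^'m \<Rightarrow> bool" where
  "hermitian_psd A \<longleftrightarrow>
     hermitian_transpose A = A \<and>
     (\<forall>x. 0 \<le> Re (\<Sum>i\<in>UNIV. cnj (x $ i) * (A *v x) $ i))"

definition psd_cone :: "(complex^'m^'m) set" where
  "psd_cone = {Q. hermitian_psd Q}"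

definition loewner_ge :: "complex^'m^'m \<Rightarrow> complex^'m^'m \<Rightarrow> bool" (infix "\<succeq>\<^sub>L" 50) where
  "A \<succeq>\<^sub>L B \<longleftrightarrow> hermitian_psd (A - B)"

definition partial_deriv :: "(real^'k \<Rightarrow> complex^'m^'t) \<Rightarrow> 'k \<Rightarrow> real^'k \<Rightarrow> complex^'m^'t" where
  "partial_deriv G i \<theta> = vector_derivative (\<lambda>h. G (\<theta> + h *\<^sub>R axis i 1)) (at 0)"

text \<open>The parameter \<open>\<sigma>2\<close> is the noise variance itself, not its square root.\<close>

definition cond_fisher_info ::
  "real \<Rightarrow> (real^'k \<Rightarrow> complex^'m^'t) \<Rightarrow> real^'k \<Rightarrow> complex^'m^'m \<Rightarrow> real^'k^'k" where
  "cond_fisher_info \<sigma>2 G \<theta> Q =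
     (\<chi> i j. 2 / \<sigma>2 *
        Re (trace (partial_deriv G j \<theta> ** Q ** hermitian_transpose (partial_deriv G i \<theta>))))"

text \<open>
  The \<open>[0, \<infinity>]\<close>-valued reading of the trace of the expected inverse: trace and expectation are
  interchanged, so that the value is defined even when the expected inverse is not finite.
  It is \<open>\<infinity>\<close> when the Fisher information matrix is singular with positive probability.
  Otherwise the trace of the inverse is nonnegative almost surely for positive semidefinite \<open>Q\<close>,
  so the truncation at \<open>0\<close> performed by \<open>ennreal\<close> has no effect on \<open>psd_cone\<close>.
\<close>

definition expected_trace_inv ::
  "'a measure \<Rightarrow> ('a \<Rightarrow> real^'k) \<Rightarrow> real \<Rightarrow> (real^'k \<Rightarrow> complex^'m^'t) \<Rightarrow>
   complex^'m^'m \<Rightarrow> ennreal" where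
  "expected_trace_inv P \<Theta> \<sigma>2 G Q =
     (if AE \<omega> in P. invertible (cond_fisher_info \<sigma>2 G (\<Theta> \<omega>) Q)
      then \<integral>\<^sup>+ \<omega>. ennreal (trace (matrix_inv (cond_fisher_info \<sigma>2 G (\<Theta> \<omega>) Q))) \<partial>P
      else \<infinity>)"

text \<open>
  Counterpart of \<^const>\<open>convex_on\<close>, which is restricted to real-valued functions. In
  \<^typ>\<open>ennreal\<close> we have \<open>0 * \<infinity> = 0\<close>, so the cases \<open>u = 0\<close> and \<open>v = 0\<close> are trivially true.
\<close>

definition ennreal_convex_on :: "'a::real_vector set \<Rightarrow> ('a \<Rightarrow> ennreal) \<Rightarrow> bool" where
  "ennreal_convex_on S f \<longleftrightarrow>
     convex S \<and>
     (\<forall>x\<in>S. \<forall>y\<in>S. \<forall>u\<ge>0. \<forall>v\<ge>0. u + v = 1 \<longrightarrow>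
        f (u *\<^sub>R x + v *\<^sub>R y) \<le> ennreal u * f x + ennreal v * f y)"

end

theory Submission
  imports Defs
begin

text \<open>
  For a positive semidefinite invertible \<open>A\<close>, completing the square gives
  \<open>x \<bullet> A\<^sup>-\<^sup>1 x = max\<^sub>y (2 x \<bullet> y - y \<bullet> A y)\<close>. The right-hand side is a supremum of functions
  that are affine and non-increasing in \<open>A\<close>, and the Fisher information is linear and monotone
  in \<open>Q\<close>. Hence the trace of its inverse is convex and non-increasing pointwise.

  Additivity of the integral, needed for convexity, requires the integrand to be measurable,
  although \<open>G\<close> is not assumed to be. At points of differentiability, the partial derivatives are
  limits of difference quotients of step size \<open>1 / n\<close> taken at base points rounded to a grid of
  mesh \<open>1 / n\<^sup>2\<close>; rounding has countable range, so these quotients are measurable for every \<open>G\<close>.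
\<close>

subsection \<open>Inverses of positive semidefinite matrices\<close>

definition real_psd :: "real^'k^'k \<Rightarrow> bool" where
  "real_psd A \<longleftrightarrow> transpose A = A \<and> (\<forall>x. 0 \<le> x \<bullet> (A *v x))"

lemma matrix_inv_cancel:
  fixes A :: "real^'k^'k"
  assumes "invertible A"
  shows "A *v (matrix_inv A *v x) = x"
proof -
  have "A ** matrix_inv A = mat 1 \<and> matrix_inv A ** A = mat 1"
    using assms unfolding invertible_def matrix_inv_def by (rule someI_ex)
  thus ?thesis by (simp add: matrix_vector_mul_assoc)
qed

lemma real_psd_inner_commute:
  assumes "real_psd A"
  shows "x \<bullet> (A *v y) = y \<bullet> (A *v x)"
  using assms unfolding real_psd_def by (metis dot_lmul_matrix inner_commute transpose_matrix_vector)

text \<open>The gap between the two sides is the quadratic form of \<open>A\<close> at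
  \<open>y - matrix_inv A *v x\<close>.\<close>

lemma completed_square_le:
  fixes A :: "real^'k^'k"
  assumes A: "real_psd A" and inv: "invertible A"
  shows "2 * (x \<bullet> y) - y \<bullet> (A *v y) \<le> x \<bullet> (matrix_inv A *v x)"
proof -
  let ?z = "matrix_inv A *v x"
  have "0 \<le> (y - ?z) \<bullet> (A *v (y - ?z))"
    using A by (simp add: real_psd_def)
  also have "\<dots> = y \<bullet> (A *v y) - y \<bullet> (A *v ?z) - ?z \<bullet> (A *v y) + ?z \<bullet> (A *v ?z)"
    by (simp add: matrix_vector_mult_diff_distrib inner_diff_left inner_diff_right)
  also have "\<dots> = y \<bullet> (A *v y) - 2 * (x \<bullet> y) + x \<bullet> ?z"
    using real_psd_inner_commute[OF A, of ?z y]
    by (simp add: matrix_inv_cancel[OF inv] inner_commute)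
  finally show ?thesis by simp
qed

text \<open>The maximum is attained at \<open>y = matrix_inv A *v x\<close>. In this form a
  comparison of inverses only has to replace the matrix in the subtracted term.\<close>

lemma completed_square_eq:
  fixes A :: "real^'k^'k"
  assumes "invertible A"
  shows "x \<bullet> (matrix_inv A *v x) =
    2 * (x \<bullet> (matrix_inv A *v x)) - (matrix_inv A *v x) \<bullet> (A *v (matrix_inv A *v x))"
  by (simp add: assms matrix_inv_cancel inner_commute)

text \<open>If the form vanishes at \<open>x\<close>, then \<open>completed_square_le\<close> at
  \<open>y = t *\<^sub>R x\<close> loses its quadratic term. It bounds
  \<open>2 * t * (x \<bullet> x)\<close> by a constant for every real \<open>t\<close>, which forces
  \<open>x = 0\<close>.\<close>

lemma real_psd_invertible_definite:
  fixes A :: "real^'k^'k"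
  assumes A: "real_psd A" "invertible A" and x: "x \<bullet> (A *v x) \<le> 0"
  shows "x = 0"
proof (rule ccontr)
  assume "x \<noteq> 0"
  hence pos: "x \<bullet> x > 0" by simp
  define c where "c = x \<bullet> (matrix_inv A *v x)"
  have x0: "x \<bullet> (A *v x) = 0"
    using A(1) x by (auto simp: real_psd_def intro: antisym)
  have le: "2 * t * (x \<bullet> x) \<le> c" for t
    using completed_square_le[OF A, of x "t *\<^sub>R x"] x0
    by (simp add: matrix_vector_mult_scaleR c_def)
  \<comment> \<open>This choice of \<open>t\<close> gives \<open>2 * (c + 1) \<le> c\<close>, while
    \<open>t = 0\<close> gives \<open>0 \<le> c\<close>.\<close>
  have "2 * ((c + 1) / (x \<bullet> x)) * (x \<bullet> x) = 2 * (c + 1)"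
    using pos by simp
  with le[of "(c + 1) / (x \<bullet> x)"] le[of 0] show False by simp
qed

lemma invertible_iff_kernel:
  fixes A :: "real^'k^'k"
  shows "invertible A \<longleftrightarrow> (\<forall>x. A *v x = 0 \<longrightarrow> x = 0)"
  by (simp add: invertible_left_inverse matrix_left_invertible_ker)

text \<open>The form of \<open>B\<close> vanishes at a kernel vector of \<open>B\<close>, hence that
  of \<open>A\<close> is at most 0 there, and \<open>A\<close> is definite.\<close>

lemma invertible_mono:
  fixes A B :: "real^'k^'k"
  assumes "real_psd A" "invertible A" and "\<And>x. x \<bullet> (A *v x) \<le> x \<bullet> (B *v x)"
  shows "invertible B"
  unfolding invertible_iff_kernel
  using assms real_psd_invertible_definite by (metis inner_zero_right)

lemma trace_eq_sum_inner:
  fixes A :: "real^'k^'k"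
  shows "trace A = (\<Sum>i\<in>UNIV. axis i 1 \<bullet> (A *v axis i 1))"
  by (simp add: trace_def inner_axis' matrix_vector_mul_component inner_axis)

lemma trace_matrix_inv_nonneg:
  fixes A :: "real^'k^'k"
  assumes "real_psd A" "invertible A"
  shows "0 \<le> trace (matrix_inv A)"
  unfolding trace_eq_sum_inner
  by (rule sum_nonneg) (use completed_square_le[OF assms, of _ 0] in simp)

text \<open>For each diagonal entry, the maximizer belonging to \<open>B\<close> is a competitor in
  the maximum for \<open>A\<close>, where its value is at least as large.\<close>

lemma trace_matrix_inv_antimono:
  fixes A B :: "real^'k^'k"
  assumes A: "real_psd A" "invertible A" and AB: "\<And>x. x \<bullet> (A *v x) \<le> x \<bullet> (B *v x)"
  shows "trace (matrix_inv B) \<le> trace (matrix_inv A)"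
  unfolding trace_eq_sum_inner
proof (rule sum_mono)
  fix i
  let ?x = "axis i 1 :: real^'k"
  have B: "invertible B" using invertible_mono[OF A AB] .
  have "?x \<bullet> (matrix_inv B *v ?x) =
      2 * (?x \<bullet> (matrix_inv B *v ?x)) - (matrix_inv B *v ?x) \<bullet> (B *v (matrix_inv B *v ?x))"
    by (rule completed_square_eq[OF B])
  also have "\<dots> \<le> 2 * (?x \<bullet> (matrix_inv B *v ?x)) - (matrix_inv B *v ?x) \<bullet> (A *v (matrix_inv B *v ?x))"
    using AB by simp
  also have "\<dots> \<le> ?x \<bullet> (matrix_inv A *v ?x)"
    by (rule completed_square_le[OF A])
  finally show "?x \<bullet> (matrix_inv B *v ?x) \<le> ?x \<bullet> (matrix_inv A *v ?x)" .
qed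

lemma inner_scaleR_add_matrix:
  fixes A B :: "real^'k^'k"
  shows "x \<bullet> ((u *\<^sub>R A + v *\<^sub>R B) *v y) = u * (x \<bullet> (A *v y)) + v * (x \<bullet> (B *v y))"
  by (simp add: matrix_vector_mult_add_rdistrib scaleR_matrix_vector_assoc[symmetric] inner_add_right)

text \<open>Both forms are nonnegative, so at a kernel vector of the combination the form of
  \<open>A\<close>, which has positive weight, must vanish.\<close>

lemma invertible_convex_combination:
  fixes A B :: "real^'k^'k"
  assumes A: "real_psd A" "invertible A" and B: "real_psd B"
    and "0 < u" "0 \<le> v"
  shows "invertible (u *\<^sub>R A + v *\<^sub>R B)"
  unfolding invertible_iff_kernel
proof (intro allI impI)
  fix x :: "real^'k"
  assume "(u *\<^sub>R A + v *\<^sub>R B) *v x = 0"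
  hence "u * (x \<bullet> (A *v x)) + v * (x \<bullet> (B *v x)) = 0"
    by (metis inner_scaleR_add_matrix inner_zero_right)
  moreover have "0 \<le> v * (x \<bullet> (B *v x))"
    using B assms(5) by (simp add: real_psd_def)
  ultimately have "u * (x \<bullet> (A *v x)) \<le> 0" by linarith
  hence "x \<bullet> (A *v x) \<le> 0"
    using assms(4) by (simp add: mult_le_0_iff)
  thus "x = 0" using real_psd_invertible_definite[OF A] by blast
qed

text \<open>The maximizer \<open>?y\<close> of the combination is a competitor for \<open>A\<close>
  and for \<open>B\<close> at once.\<close>

lemma trace_matrix_inv_convex:
  fixes A B :: "real^'k^'k"
  assumes A: "real_psd A" "invertible A" and B: "real_psd B" "invertible B"
    and uv: "0 < u" "0 < v" "u + v = 1"
  shows "trace (matrix_inv (u *\<^sub>R A + v *\<^sub>R B)) \<le> u * trace (matrix_inv A) + v * trace (matrix_inv B)"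
  unfolding trace_eq_sum_inner sum_distrib_left sum.distrib[symmetric]
proof (rule sum_mono)
  fix i
  let ?C = "u *\<^sub>R A + v *\<^sub>R B"
  let ?x = "axis i 1 :: real^'k"
  let ?y = "matrix_inv ?C *v ?x"
  have C: "invertible ?C"
    using invertible_convex_combination[OF A B(1)] uv by simp
  have "?x \<bullet> ?y = 2 * (?x \<bullet> ?y) - ?y \<bullet> (?C *v ?y)"
    by (rule completed_square_eq[OF C])
  \<comment> \<open>Since \<open>u + v = 1\<close>, the linear term can be shared between the two
    matrices in proportion to their weights.\<close>
  also have "\<dots> = (u + v) * (2 * (?x \<bullet> ?y)) - (u * (?y \<bullet> (A *v ?y)) + v * (?y \<bullet> (B *v ?y)))"
    unfolding inner_scaleR_add_matrix uv(3) by simp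
  also have "\<dots> = u * (2 * (?x \<bullet> ?y) - ?y \<bullet> (A *v ?y)) + v * (2 * (?x \<bullet> ?y) - ?y \<bullet> (B *v ?y))"
    by (simp only: algebra_simps)
  also have "\<dots> \<le> u * (?x \<bullet> (matrix_inv A *v ?x)) + v * (?x \<bullet> (matrix_inv B *v ?x))"
    using completed_square_le[OF A] completed_square_le[OF B] uv
    by (intro add_mono mult_left_mono) auto
  finally show "?x \<bullet> ?y \<le> u * (?x \<bullet> (matrix_inv A *v ?x)) + v * (?x \<bullet> (matrix_inv B *v ?x))" .
qed

subsection \<open>The Fisher information as a linear monotone function\<close>

text \<open>Serves for convex combinations and, with coefficients 1 and -1, for differences in the
  Loewner order.\<close>

lemma cond_fisher_info_linear:
  fixes G :: "real^'k \<Rightarrow> complex^'m^'t"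
  shows "cond_fisher_info \<sigma>2 G \<theta> (u *\<^sub>R Q + v *\<^sub>R R) =
     u *\<^sub>R cond_fisher_info \<sigma>2 G \<theta> Q + v *\<^sub>R cond_fisher_info \<sigma>2 G \<theta> R"
proof -
  have "trace (A ** (u *\<^sub>R Q + v *\<^sub>R R) ** B) = u *\<^sub>R trace (A ** Q ** B) + v *\<^sub>R trace (A ** R ** B)"
    for A :: "complex^'m^'t" and B :: "complex^'t^'m"
    by (simp add: trace_def matrix_matrix_mult_def ring_distribs sum.distrib scaleR_sum_right
        sum_distrib_right)
  thus ?thesis
    by (simp add: cond_fisher_info_def vec_eq_iff algebra_simps add_divide_distrib)
qed

lemma hermitian_transpose_mult:
  "hermitian_transpose (A ** B) = hermitian_transpose B ** hermitian_transpose A"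
  by (simp add: hermitian_transpose_def matrix_matrix_mult_def vec_eq_iff mult.commute)

lemma hermitian_transpose_hermitian_transpose [simp]:
  "hermitian_transpose (hermitian_transpose A) = A"
  by (simp add: hermitian_transpose_def vec_eq_iff)

lemma Re_trace_hermitian_transpose:
  "Re (trace (hermitian_transpose A)) = Re (trace A)"
  by (simp add: hermitian_transpose_def trace_def)

text \<open>With D the sum of the partial derivatives weighted by \<open>x\<close>, the form is
  \<open>2 / \<sigma>2\<close> times the real trace of D Q D^H. Its diagonal entry at
  \<open>t\<close> is the form of \<open>Q\<close> at the conjugate of row \<open>t\<close> of D, so
  positivity is inherited from \<open>Q\<close>.\<close>

lemma cond_fisher_info_quadratic_form:
  "x \<bullet> (cond_fisher_info \<sigma>2 G \<theta> Q *v x) =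
     2 / \<sigma>2 * (\<Sum>t\<in>UNIV. Re (\<Sum>n\<in>UNIV.
        cnj ((\<chi> n. cnj (\<Sum>j\<in>UNIV. x $ j *\<^sub>R partial_deriv G j \<theta> $ t $ n)) $ n) *
        (Q *v (\<chi> n. cnj (\<Sum>j\<in>UNIV. x $ j *\<^sub>R partial_deriv G j \<theta> $ t $ n))) $ n))"
  (is "?lhs = ?rhs")
proof -
  let ?D = "\<lambda>j. partial_deriv G j \<theta>"
  let ?T = "\<lambda>i j t n m. x $ i * x $ j * Re (?D j $ t $ n * Q $ n $ m * cnj (?D i $ t $ m))"
  have "?lhs = (\<Sum>i\<in>UNIV. \<Sum>j\<in>UNIV. 2 / \<sigma>2 * (\<Sum>t\<in>UNIV. \<Sum>m\<in>UNIV. \<Sum>n\<in>UNIV. ?T i j t n m))"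
    unfolding inner_vec_def matrix_vector_mult_def cond_fisher_info_def trace_def
      matrix_matrix_mult_def hermitian_transpose_def
    by (simp add: sum_distrib_left sum_distrib_right mult_ac)
  also have "\<dots> = 2 / \<sigma>2 * (\<Sum>i\<in>UNIV. \<Sum>j\<in>UNIV. \<Sum>t\<in>UNIV. \<Sum>m\<in>UNIV. \<Sum>n\<in>UNIV. ?T i j t n m)"
    by (simp only: sum_distrib_left)
  also have "(\<Sum>i\<in>UNIV. \<Sum>j\<in>UNIV. \<Sum>t\<in>UNIV. \<Sum>m\<in>UNIV. \<Sum>n\<in>UNIV. ?T i j t n m) =
      (\<Sum>(i, j, t, m, n)\<in>UNIV. ?T i j t n m)"
    by (simp add: sum.cartesian_product flip: UNIV_Times_UNIV)
  \<comment> \<open>One bijection of index tuples replaces a chain of sum interchanges.\<close>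
  also have "\<dots> = (\<Sum>(t, n, m, i, j)\<in>UNIV. ?T i j t n m)"
    by (rule sum.reindex_bij_witness[where
          i = "\<lambda>(t, n, m, i, j). (i, j, t, m, n)" and j = "\<lambda>(i, j, t, m, n). (t, n, m, i, j)"]) auto
  also have "\<dots> = (\<Sum>t\<in>UNIV. \<Sum>n\<in>UNIV. \<Sum>m\<in>UNIV. \<Sum>i\<in>UNIV. \<Sum>j\<in>UNIV. ?T i j t n m)"
    by (simp add: sum.cartesian_product flip: UNIV_Times_UNIV)
  also have "\<dots> = (\<Sum>t\<in>UNIV. Re (\<Sum>n\<in>UNIV. \<Sum>m\<in>UNIV. \<Sum>i\<in>UNIV. \<Sum>j\<in>UNIV.
      (x $ j *\<^sub>R ?D j $ t $ n) * (Q $ n $ m * cnj (x $ i *\<^sub>R ?D i $ t $ m))))"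
    by (simp add: algebra_simps)
  also have "\<dots> = (\<Sum>t\<in>UNIV. Re (\<Sum>n\<in>UNIV.
        cnj ((\<chi> n. cnj (\<Sum>j\<in>UNIV. x $ j *\<^sub>R partial_deriv G j \<theta> $ t $ n)) $ n) *
        (Q *v (\<chi> n. cnj (\<Sum>j\<in>UNIV. x $ j *\<^sub>R partial_deriv G j \<theta> $ t $ n))) $ n))"
    unfolding matrix_vector_mult_def
    by (simp only: vec_lambda_beta cnj_sum complex_cnj_cnj sum_distrib_left sum_distrib_right)
  finally show ?thesis .
qed

lemma cond_fisher_info_psd:
  fixes G :: "real^'k \<Rightarrow> complex^'m^'t"
  assumes "hermitian_psd Q" and "\<sigma>2 > 0"
  shows "real_psd (cond_fisher_info \<sigma>2 G \<theta> Q)"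
  unfolding real_psd_def
proof (intro conjI allI)
  \<comment> \<open>Symmetry of the information: the Hermitian transpose swaps the two derivatives,
    as \<open>Q\<close> is Hermitian, and preserves the real part of the trace.\<close>
  have "Re (trace (A ** Q ** hermitian_transpose B)) = Re (trace (B ** Q ** hermitian_transpose A))"
    for A B :: "complex^'m^'t"
  proof -
    have "hermitian_transpose Q = Q" using assms(1) by (simp add: hermitian_psd_def)
    hence "hermitian_transpose (A ** Q ** hermitian_transpose B) = B ** Q ** hermitian_transpose A"
      by (simp add: hermitian_transpose_mult matrix_mul_assoc)
    thus ?thesis by (metis Re_trace_hermitian_transpose)
  qed
  thus "transpose (cond_fisher_info \<sigma>2 G \<theta> Q) = cond_fisher_info \<sigma>2 G \<theta> Q"
    by (simp add: transpose_def cond_fisher_info_def vec_eq_iff)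
next
  fix x
  show "0 \<le> x \<bullet> (cond_fisher_info \<sigma>2 G \<theta> Q *v x)"
    unfolding cond_fisher_info_quadratic_form
    using assms(2)
    by (intro mult_nonneg_nonneg sum_nonneg assms(1)[unfolded hermitian_psd_def, THEN conjunct2, rule_format])
      simp
qed

lemma cond_fisher_info_mono:
  assumes "Q1 \<succeq>\<^sub>L Q2" and "\<sigma>2 > 0"
  shows "x \<bullet> (cond_fisher_info \<sigma>2 G \<theta> Q2 *v x) \<le> x \<bullet> (cond_fisher_info \<sigma>2 G \<theta> Q1 *v x)"
proof -
  have "real_psd (cond_fisher_info \<sigma>2 G \<theta> (1 *\<^sub>R Q1 + (- 1) *\<^sub>R Q2))"
    using cond_fisher_info_psd[OF _ assms(2), of "Q1 - Q2"] assms(1) by (simp add: loewner_ge_def)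
  hence "0 \<le> x \<bullet> (cond_fisher_info \<sigma>2 G \<theta> (1 *\<^sub>R Q1 + (- 1) *\<^sub>R Q2) *v x)"
    unfolding real_psd_def by blast
  thus ?thesis
    unfolding cond_fisher_info_linear inner_scaleR_add_matrix by simp
qed

lemma convex_psd_cone: "convex (psd_cone :: (complex^'m^'m) set)"
proof (rule convexI)
  fix A B :: "complex^'m^'m" and u v :: real
  assume A: "A \<in> psd_cone" and B: "B \<in> psd_cone" and uv: "0 \<le> u" "0 \<le> v"
  let ?q = "\<lambda>A x. Re (\<Sum>i\<in>UNIV. cnj (x $ i) * ((A :: complex^'m^'m) *v x) $ i)"
  have "(u *\<^sub>R A + v *\<^sub>R B) *v x = u *\<^sub>R (A *v x) + v *\<^sub>R (B *v x)" for x
    by (simp add: matrix_vector_mult_def vec_eq_iff ring_distribs sum.distrib scaleR_sum_right)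
  hence "?q (u *\<^sub>R A + v *\<^sub>R B) x = u * ?q A x + v * ?q B x" for x
    by (simp add: ring_distribs sum.distrib sum_distrib_left mult_ac)
  moreover have "0 \<le> u * ?q A x + v * ?q B x" for x
    using A B uv unfolding psd_cone_def hermitian_psd_def mem_Collect_eq
    by (intro add_nonneg_nonneg mult_nonneg_nonneg) blast+
  moreover have "hermitian_transpose (u *\<^sub>R A + v *\<^sub>R B) =
      u *\<^sub>R hermitian_transpose A + v *\<^sub>R hermitian_transpose B"
    by (simp add: hermitian_transpose_def vec_eq_iff)
  ultimately show "u *\<^sub>R A + v *\<^sub>R B \<in> psd_cone"
    using A B unfolding psd_cone_def hermitian_psd_def mem_Collect_eq by metis
qed

subsection \<open>Measurability of the partial derivatives\<close>

text \<open>The squared mesh keeps the rounding error, even after multiplication by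
  \<open>Suc n\<close>, bounded in \<open>n\<close>. Using \<open>Suc n\<close> avoids a zero
  denominator.\<close>

definition grid_round :: "nat \<Rightarrow> real^'k \<Rightarrow> real^'k" where
  "grid_round n x = (\<chi> i. of_int \<lfloor>(real (Suc n))\<^sup>2 * x $ i\<rfloor> / (real (Suc n))\<^sup>2)"

text \<open>The map factors through the countable type \<open>int^'k\<close> of grid indices, and on
  a discrete space every function is measurable.\<close>

lemma borel_measurable_compose_grid_round:
  fixes G :: "real^'k \<Rightarrow> 'b::topological_space"
  shows "(\<lambda>x. G (grid_round n x + c)) \<in> borel_measurable borel"
proof -
  let ?fl = "\<lambda>x :: real^'k. (\<chi> i. \<lfloor>(real (Suc n))\<^sup>2 * x $ i\<rfloor>) :: int^'k"
  have "?fl \<in> borel \<rightarrow>\<^sub>M count_space UNIV"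
  proof (subst measurable_count_space_eq2_countable, safe)
    fix v :: "int^'k"
    have "?fl -` {v} \<inter> space borel = {x \<in> space borel. \<forall>i. \<lfloor>(real (Suc n))\<^sup>2 * x $ i\<rfloor> = v $ i}"
      by (auto simp: vec_eq_iff)
    also have "\<dots> \<in> sets borel"
      by measurable
    finally show "?fl -` {v} \<inter> space borel \<in> sets borel" .
  qed auto
  hence "(\<lambda>x. (\<lambda>v. G ((\<chi> i. of_int (v $ i) / (real (Suc n))\<^sup>2) + c)) (?fl x)) \<in> borel_measurable borel"
    by (rule measurable_compose) simp
  thus ?thesis by (simp add: grid_round_def)
qed

lemma norm_grid_round_diff_le:
  fixes x :: "real^'k"
  shows "norm (grid_round n x - x) \<le> real CARD('k) / (real (Suc n))\<^sup>2"
proof -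
  let ?a = "(real (Suc n))\<^sup>2"
  have a: "?a > 0" by simp
  have "\<bar>(grid_round n x - x) $ i\<bar> \<le> 1 / ?a" for i
  proof -
    have "(grid_round n x - x) $ i = (of_int \<lfloor>?a * x $ i\<rfloor> - ?a * x $ i) / ?a"
      using a by (simp add: grid_round_def field_simps del: of_nat_Suc)
    moreover have "\<bar>of_int \<lfloor>?a * x $ i\<rfloor> - ?a * x $ i\<bar> \<le> 1"
      by linarith
    ultimately show ?thesis
      using a by (simp only: abs_divide) (simp add: divide_right_mono)
  qed
  hence "(\<Sum>i\<in>UNIV. \<bar>(grid_round n x - x) $ i\<bar>) \<le> (\<Sum>i\<in>(UNIV :: 'k set). 1 / ?a)"
    by (intro sum_mono)
  thus ?thesis
    using norm_le_l1_cart[of "grid_round n x - x"] by simp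
qed

text \<open>The remainder is of smaller order than \<open>norm (p n - x)\<close>, and
  \<open>a n\<close> grows at most like the reciprocal of that norm.\<close>

lemma has_derivative_scaled_remainder:
  fixes f :: "'b::real_normed_vector \<Rightarrow> 'c::real_normed_vector"
  assumes f: "(f has_derivative L) (at x)"
    and p: "p \<longlonglongrightarrow> x" and C: "\<And>n. a n * norm (p n - x) \<le> C" and a: "\<And>n. a n > 0"
  shows "(\<lambda>n. a n *\<^sub>R (f (p n) - f x - L (p n - x))) \<longlonglongrightarrow> 0"
proof (rule LIMSEQ_I)
  fix r :: real assume r: "0 < r"
  have C0: "0 \<le> C"
    using C[of 0] a[of 0] by (meson less_imp_le mult_nonneg_nonneg norm_ge_zero order_trans)
  \<comment> \<open>Adding 1 covers \<open>C = 0\<close> and makes the final estimate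
    strict.\<close>
  define e where "e = r / (C + 1)"
  have e: "e > 0" using r C0 by (simp add: e_def)
  obtain d where d: "d > 0"
    "\<And>y. norm (y - x) < d \<Longrightarrow> norm (f y - f x - L (y - x)) \<le> e * norm (y - x)"
    using f e unfolding has_derivative_at_alt by blast
  obtain N where N: "\<And>n. n \<ge> N \<Longrightarrow> norm (p n - x) < d"
    using LIMSEQ_D[OF p d(1)] by blast
  show "\<exists>no. \<forall>n\<ge>no. norm (a n *\<^sub>R (f (p n) - f x - L (p n - x)) - 0) < r"
  proof (intro exI allI impI)
    fix n assume "n \<ge> N"
    have "norm (a n *\<^sub>R (f (p n) - f x - L (p n - x)) - 0) = a n * norm (f (p n) - f x - L (p n - x))"
      using a[of n] by simp
    also have "\<dots> \<le> a n * (e * norm (p n - x))"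
      using d(2)[OF N[OF \<open>n \<ge> N\<close>]] a[of n] by simp
    also have "\<dots> = e * (a n * norm (p n - x))" by simp
    also have "\<dots> \<le> e * C" using C e by simp
    also have "\<dots> < e * (C + 1)" using e by simp
    also have "\<dots> = r" using C0 by (simp add: e_def)
    finally show "norm (a n *\<^sub>R (f (p n) - f x - L (p n - x)) - 0) < r" .
  qed
qed

lemma partial_deriv_eq:
  assumes "(G has_derivative L) (at x)"
  shows "partial_deriv G i x = L (axis i 1)"
proof -
  have "((\<lambda>h. x + h *\<^sub>R axis i 1) has_derivative (\<lambda>h. h *\<^sub>R axis i 1)) (at (0::real))"
    by (auto intro!: derivative_eq_intros)
  moreover have "(G has_derivative L) (at (x + 0 *\<^sub>R axis i 1))"
    using assms by simp
  ultimately have "((\<lambda>h. G (x + h *\<^sub>R axis i 1)) has_derivative (\<lambda>h. L (h *\<^sub>R axis i 1))) (at 0)"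
    by (rule has_derivative_compose)
  moreover have "L (h *\<^sub>R axis i 1) = h *\<^sub>R L (axis i 1)" for h
    using assms by (simp add: has_derivative_def linear_simps)
  ultimately have "((\<lambda>h. G (x + h *\<^sub>R axis i 1)) has_vector_derivative L (axis i 1)) (at 0)"
    by (simp add: has_vector_derivative_def)
  thus ?thesis
    unfolding partial_deriv_def by (rule vector_derivative_at)
qed

text \<open>The \<open>+ 0\<close> gives both evaluations of \<open>G\<close> the shape required by
  \<open>borel_measurable_compose_grid_round\<close>.\<close>

definition grid_quotient :: "(real^'k \<Rightarrow> complex^'m^'t) \<Rightarrow> 'k \<Rightarrow> nat \<Rightarrow> real^'k \<Rightarrow> complex^'m^'t" where
  "grid_quotient G i n x =
     real (Suc n) *\<^sub>R (G (grid_round n x + (1 / real (Suc n)) *\<^sub>R axis i 1) - G (grid_round n x + 0))"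

text \<open>Neither evaluation point need be \<open>x\<close>, so each value of \<open>G\<close> is
  expanded around \<open>x\<close> by the total derivative. Both points are within a constant times
  \<open>1 / Suc n\<close> of \<open>x\<close>, so the scaled remainders vanish.\<close>

lemma grid_quotient_tendsto:
  fixes G :: "real^'k \<Rightarrow> complex^'m^'t"
  assumes "G differentiable (at x)"
  shows "(\<lambda>n. grid_quotient G i n x) \<longlonglongrightarrow> partial_deriv G i x"
proof -
  obtain L where L: "(G has_derivative L) (at x)"
    using assms by (auto simp: differentiable_def)
  interpret L: bounded_linear L using L by (rule has_derivative_bounded_linear)
  \<comment> \<open>The evaluation points of the quotient are \<open>p 1 n\<close> and
    \<open>p 0 n\<close>.\<close>
  define p where "p = (\<lambda>c n. grid_round n x + (c / real (Suc n)) *\<^sub>R axis i (1::real))"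
  have bound: "real (Suc n) * norm (p c n - x) \<le> real CARD('k) + \<bar>c\<bar>" for c n
  proof -
    have "norm (p c n - x) \<le> norm (grid_round n x - x) + norm ((c / real (Suc n)) *\<^sub>R axis i (1::real) :: real^'k)"
      unfolding p_def by (metis add_diff_eq add.commute add.left_commute norm_triangle_ineq diff_add_eq)
    also have "\<dots> \<le> real CARD('k) / (real (Suc n))\<^sup>2 + \<bar>c\<bar> / real (Suc n)"
      using norm_grid_round_diff_le[of n x] by (simp add: norm_axis_1)
    finally have "real (Suc n) * norm (p c n - x)
        \<le> real (Suc n) * (real CARD('k) / (real (Suc n))\<^sup>2 + \<bar>c\<bar> / real (Suc n))"
      by (intro mult_left_mono) auto
    also have "\<dots> = real CARD('k) / real (Suc n) + \<bar>c\<bar>"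
      by (simp add: power2_eq_square ring_distribs del: of_nat_Suc)
    also have "real CARD('k) / real (Suc n) \<le> real CARD('k)"
      using mult_left_mono[of 1 "real (Suc n)" "real CARD('k)"] by (simp add: divide_le_eq del: of_nat_Suc)
    finally show ?thesis by simp
  qed
  have lim: "p c \<longlonglongrightarrow> x" for c
  proof -
    have "(\<lambda>n. (real CARD('k) + \<bar>c\<bar>) * inverse (real (Suc n))) \<longlonglongrightarrow> (real CARD('k) + \<bar>c\<bar>) * 0"
      by (intro tendsto_mult tendsto_const LIMSEQ_inverse_real_of_nat)
    moreover have "norm (p c n - x) \<le> (real CARD('k) + \<bar>c\<bar>) * inverse (real (Suc n))" for n
      using bound[of n c] by (simp add: field_simps)
    ultimately have "(\<lambda>n. p c n - x) \<longlonglongrightarrow> 0"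
      by (intro Lim_null_comparison[of "\<lambda>n. p c n - x"]) auto
    thus ?thesis by (rule LIM_zero_cancel)
  qed
  have rem: "(\<lambda>n. real (Suc n) *\<^sub>R (G (p c n) - G x - L (p c n - x))) \<longlonglongrightarrow> 0" for c
    by (rule has_derivative_scaled_remainder[OF L lim bound]) simp
  \<comment> \<open>The rounding error cancels in \<open>p 1 n - p 0 n\<close>, so the linear parts
    contribute exactly \<open>L (axis i 1)\<close>.\<close>
  have "grid_quotient G i n x - L (axis i 1) =
      real (Suc n) *\<^sub>R (G (p 1 n) - G x - L (p 1 n - x)) -
      real (Suc n) *\<^sub>R (G (p 0 n) - G x - L (p 0 n - x))" for n
  proof -
    have "L (p 1 n - x) - L (p 0 n - x) = (1 / real (Suc n)) *\<^sub>R L (axis i 1)"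
      unfolding L.diff[symmetric] p_def by (simp add: L.scaleR del: of_nat_Suc)
    hence "real (Suc n) *\<^sub>R (L (p 1 n - x) - L (p 0 n - x)) = L (axis i 1)"
      by (simp del: of_nat_Suc)
    thus ?thesis
      unfolding grid_quotient_def p_def by (simp add: algebra_simps del: of_nat_Suc)
  qed
  hence "(\<lambda>n. grid_quotient G i n x - L (axis i 1)) \<longlonglongrightarrow> 0"
    using tendsto_diff[OF rem[of 1] rem[of 0]] by simp
  thus ?thesis
    unfolding partial_deriv_eq[OF L] by (rule LIM_zero_cancel)
qed

text \<open>Supplies a measurable function that agrees with \<open>partial_deriv G i\<close>
  wherever \<open>G\<close> is differentiable.\<close>

lemma borel_measurable_grid_quotient_lim:
  fixes G :: "real^'k \<Rightarrow> complex^'m^'t"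
  shows "(\<lambda>x. lim (\<lambda>n. grid_quotient G i n x)) \<in> borel_measurable borel"
  unfolding grid_quotient_def
  by (intro borel_measurable_lim_metric borel_measurable_scaleR borel_measurable_diff
      borel_measurable_const borel_measurable_compose_grid_round)

subsection \<open>Measurability of the trace of the inverse\<close>

lemma borel_measurable_vec_nth2:
  fixes f :: "'a \<Rightarrow> ('b::euclidean_space)^'j^'i"
  assumes "f \<in> borel_measurable M"
  shows "(\<lambda>w. f w $ i $ j) \<in> borel_measurable M"
proof -
  have "continuous_on UNIV (\<lambda>x :: 'b^'j^'i. x $ i $ j)"
    by (intro continuous_intros)
  from borel_measurable_continuous_on[OF this assms] show ?thesis .
qed

lemma borel_measurable_det:
  fixes f :: "'a \<Rightarrow> real^'k^'k"
  assumes "\<And>i j. (\<lambda>w. f w $ i $ j) \<in> borel_measurable M"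
  shows "(\<lambda>w. det (f w)) \<in> borel_measurable M"
  unfolding det_def using assms by measurable

text \<open>
  On singular matrices \<^const>\<open>matrix_inv\<close> has a constant value, the choice from an empty predicate.
\<close>

lemma borel_measurable_trace_matrix_inv:
  fixes f :: "'a \<Rightarrow> real^'k^'k"
  assumes f: "\<And>i j. (\<lambda>w. f w $ i $ j) \<in> borel_measurable M"
  shows "(\<lambda>w. trace (matrix_inv (f w))) \<in> borel_measurable M"
proof -
  let ?c = "trace (SOME A :: real^'k^'k. False)"
  \<comment> \<open>Cramer's rule: \<open>?B A k\<close> is \<open>A\<close> with column
    \<open>k\<close> replaced by the unit vector, so the diagonal of the inverse is a quotient of
    determinants.\<close>
  let ?B = "\<lambda>A k. (\<chi> i j. if j = k then axis k 1 $ i else A $ i $ j) :: real^'k^'k"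
  have inv: "trace (matrix_inv A) = (if det A = 0 then ?c else \<Sum>k\<in>UNIV. det (?B A k) / det A)"
    for A :: "real^'k^'k"
  proof (cases "det A = 0")
    case True
    hence "\<not> invertible A" by (simp add: invertible_det_nz)
    hence "(\<lambda>A'. A ** A' = mat 1 \<and> A' ** A = mat 1) = (\<lambda>_. False)"
      unfolding invertible_def by blast
    thus ?thesis using True by (simp add: matrix_inv_def)
  next
    case False
    hence "invertible A" by (simp add: invertible_det_nz)
    have "matrix_inv A $ k $ k = det (?B A k) / det A" for k
    proof -
      have "matrix_inv A *v axis k 1 =
          (\<chi> l. det (\<chi> i j. if j = l then axis k 1 $ i else A $ i $ j) / det A)"
        using cramer[OF False, of "matrix_inv A *v axis k 1" "axis k 1"]
          matrix_inv_cancel[OF \<open>invertible A\<close>] by blast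
      hence "(matrix_inv A *v axis k 1) $ k = det (?B A k) / det A" by simp
      thus ?thesis by (simp add: matrix_vector_mul_component inner_axis)
    qed
    thus ?thesis using False by (simp add: trace_def)
  qed
  have "(\<lambda>w. det (?B (f w) k)) \<in> borel_measurable M" for k
    by (rule borel_measurable_det) (use f in simp)
  moreover have "(\<lambda>w. det (f w)) \<in> borel_measurable M"
    by (rule borel_measurable_det[OF f])
  ultimately show ?thesis
    unfolding inv by measurable
qed

text \<open>Replacing each partial derivative by its grid limit changes the integrand only on a null
  set and makes it measurable.\<close>

lemma AE_eq_measurable_trace_inv_fisher:
  fixes G :: "real^'k \<Rightarrow> complex^'m^'t"
  assumes \<Theta>: "\<Theta> \<in> borel_measurable P" and "AE \<omega> in P. G differentiable (at (\<Theta> \<omega>))"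
  obtains h where "h \<in> borel_measurable P"
    "AE \<omega> in P. trace (matrix_inv (cond_fisher_info \<sigma>2 G (\<Theta> \<omega>) Q)) = h \<omega>"
proof
  let ?D = "\<lambda>i x. lim (\<lambda>n. grid_quotient G i n x)"
  let ?J = "\<lambda>x. (\<chi> i j. 2 / \<sigma>2 * Re (trace (?D j x ** Q ** hermitian_transpose (?D i x)))) :: real^'k^'k"
  have [measurable]: "(\<lambda>\<omega>. ?D i (\<Theta> \<omega>) $ t $ m) \<in> borel_measurable P" for i t m
    by (intro borel_measurable_vec_nth2 measurable_compose[OF \<Theta> borel_measurable_grid_quotient_lim])
  have [measurable]: "cnj \<in> borel_measurable borel"
    by (intro borel_measurable_continuous_onI continuous_intros)
  show "(\<lambda>\<omega>. trace (matrix_inv (?J (\<Theta> \<omega>)))) \<in> borel_measurable P"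
    by (rule borel_measurable_trace_matrix_inv)
      (simp add: trace_def matrix_matrix_mult_def hermitian_transpose_def del: Re_sum)
  show "AE \<omega> in P. trace (matrix_inv (cond_fisher_info \<sigma>2 G (\<Theta> \<omega>) Q)) = trace (matrix_inv (?J (\<Theta> \<omega>)))"
    using assms(2)
  proof eventually_elim
    case (elim \<omega>)
    hence "partial_deriv G i (\<Theta> \<omega>) = ?D i (\<Theta> \<omega>)" for i
      by (metis grid_quotient_tendsto limI)
    thus ?case by (simp add: cond_fisher_info_def)
  qed
qed

section \<open>Monotonicity and convexity of the expected trace\<close>

lemma expected_trace_inv_antimono:
  assumes "Q2 \<in> psd_cone" "Q1 \<succeq>\<^sub>L Q2" "\<sigma>2 > 0"
  shows "expected_trace_inv P \<Theta> \<sigma>2 G Q1 \<le> expected_trace_inv P \<Theta> \<sigma>2 G Q2"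
proof (cases "AE \<omega> in P. invertible (cond_fisher_info \<sigma>2 G (\<Theta> \<omega>) Q2)")
  case True
  let ?J = "\<lambda>Q \<omega>. cond_fisher_info \<sigma>2 G (\<Theta> \<omega>) Q"
  have psd: "real_psd (?J Q2 \<omega>)" for \<omega>
    using assms by (intro cond_fisher_info_psd) (auto simp: psd_cone_def)
  note mono = cond_fisher_info_mono[OF assms(2,3)]
  have "AE \<omega> in P. invertible (?J Q1 \<omega>)"
    using True by eventually_elim (rule invertible_mono[OF psd _ mono])
  moreover have "(\<integral>\<^sup>+ \<omega>. ennreal (trace (matrix_inv (?J Q1 \<omega>))) \<partial>P)
      \<le> (\<integral>\<^sup>+ \<omega>. ennreal (trace (matrix_inv (?J Q2 \<omega>))) \<partial>P)"
  proof (rule nn_integral_mono_AE)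
    show "AE \<omega> in P. ennreal (trace (matrix_inv (?J Q1 \<omega>))) \<le> ennreal (trace (matrix_inv (?J Q2 \<omega>)))"
      using True by eventually_elim (intro ennreal_leI trace_matrix_inv_antimono[OF psd _ mono])
  qed
  ultimately show ?thesis
    using True by (simp add: expected_trace_inv_def)
\<comment> \<open>Otherwise the value at \<open>Q2\<close> is infinite.\<close>
qed (simp add: expected_trace_inv_def)

lemma expected_trace_inv_convex:
  fixes G :: "real^'k \<Rightarrow> complex^'m^'t"
  assumes \<Theta>: "\<Theta> \<in> borel_measurable P" and diff: "AE \<omega> in P. G differentiable (at (\<Theta> \<omega>))"
    and \<sigma>2: "\<sigma>2 > 0" and Q: "Q1 \<in> psd_cone" "Q2 \<in> psd_cone" and uv: "0 < u" "0 < v" "u + v = 1"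
  shows "expected_trace_inv P \<Theta> \<sigma>2 G (u *\<^sub>R Q1 + v *\<^sub>R Q2) \<le>
    ennreal u * expected_trace_inv P \<Theta> \<sigma>2 G Q1 + ennreal v * expected_trace_inv P \<Theta> \<sigma>2 G Q2"
proof -
  let ?J = "\<lambda>Q \<omega>. cond_fisher_info \<sigma>2 G (\<Theta> \<omega>) Q"
  let ?f = "\<lambda>Q \<omega>. trace (matrix_inv (?J Q \<omega>))"
  let ?Q = "u *\<^sub>R Q1 + v *\<^sub>R Q2"
  show ?thesis
  proof (cases "(AE \<omega> in P. invertible (?J Q1 \<omega>)) \<and> (AE \<omega> in P. invertible (?J Q2 \<omega>))")
    case True
    hence inv: "AE \<omega> in P. invertible (?J Q1 \<omega>)" "AE \<omega> in P. invertible (?J Q2 \<omega>)" by auto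
    have psd: "real_psd (?J Q1 \<omega>)" "real_psd (?J Q2 \<omega>)" for \<omega>
      using Q \<sigma>2 by (auto intro!: cond_fisher_info_psd simp: psd_cone_def)
    have invQ: "AE \<omega> in P. invertible (?J ?Q \<omega>)"
      using inv(1)
    proof eventually_elim
      case (elim \<omega>)
      show ?case
        unfolding cond_fisher_info_linear
        using elim uv by (intro invertible_convex_combination psd) auto
    qed
    \<comment> \<open>The measurable versions \<open>h1\<close> and \<open>h2\<close> stand in for
      the integrands at \<open>Q1\<close> and \<open>Q2\<close>, so that the integral of the
      weighted sum can be split.\<close>
    obtain h1 where h1: "h1 \<in> borel_measurable P" "AE \<omega> in P. ?f Q1 \<omega> = h1 \<omega>"
      using AE_eq_measurable_trace_inv_fisher[OF \<Theta> diff] by metis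
    obtain h2 where h2: "h2 \<in> borel_measurable P" "AE \<omega> in P. ?f Q2 \<omega> = h2 \<omega>"
      using AE_eq_measurable_trace_inv_fisher[OF \<Theta> diff] by metis
    have I1: "(\<integral>\<^sup>+ \<omega>. ennreal (?f Q1 \<omega>) \<partial>P) = (\<integral>\<^sup>+ \<omega>. ennreal (h1 \<omega>) \<partial>P)"
      by (rule nn_integral_cong_AE) (use h1(2) in eventually_elim, simp)
    have I2: "(\<integral>\<^sup>+ \<omega>. ennreal (?f Q2 \<omega>) \<partial>P) = (\<integral>\<^sup>+ \<omega>. ennreal (h2 \<omega>) \<partial>P)"
      by (rule nn_integral_cong_AE) (use h2(2) in eventually_elim, simp)
    have "(\<integral>\<^sup>+ \<omega>. ennreal (?f ?Q \<omega>) \<partial>P) \<le>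
        (\<integral>\<^sup>+ \<omega>. ennreal u * ennreal (h1 \<omega>) + ennreal v * ennreal (h2 \<omega>) \<partial>P)"
    proof (rule nn_integral_mono_AE)
      show "AE \<omega> in P. ennreal (?f ?Q \<omega>) \<le> ennreal u * ennreal (h1 \<omega>) + ennreal v * ennreal (h2 \<omega>)"
        using inv h1(2) h2(2)
      proof eventually_elim
        case (elim \<omega>)
        \<comment> \<open>Nonnegativity lets \<open>ennreal\<close> distribute over the weighted sum
          without truncation.\<close>
        have nonneg: "0 \<le> ?f Q1 \<omega>" "0 \<le> ?f Q2 \<omega>"
          using elim psd trace_matrix_inv_nonneg by blast+
        have "?f ?Q \<omega> \<le> u * ?f Q1 \<omega> + v * ?f Q2 \<omega>"
          unfolding cond_fisher_info_linear
          by (rule trace_matrix_inv_convex[OF psd(1) elim(1) psd(2) elim(2) uv])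
        hence "ennreal (?f ?Q \<omega>) \<le> ennreal (u * ?f Q1 \<omega> + v * ?f Q2 \<omega>)"
          by (rule ennreal_leI)
        also have "\<dots> = ennreal u * ennreal (?f Q1 \<omega>) + ennreal v * ennreal (?f Q2 \<omega>)"
          using nonneg uv by (simp add: ennreal_plus ennreal_mult)
        finally show ?case using elim by simp
      qed
    qed
    also have "\<dots> = ennreal u * (\<integral>\<^sup>+ \<omega>. ennreal (h1 \<omega>) \<partial>P) + ennreal v * (\<integral>\<^sup>+ \<omega>. ennreal (h2 \<omega>) \<partial>P)"
      using h1(1) h2(1) by (simp add: nn_integral_add nn_integral_cmult)
    finally show ?thesis
      using inv invQ by (simp add: expected_trace_inv_def I1 I2)
  \<comment> \<open>Some value on the right is infinite, and its positive weight keeps the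
    right-hand side infinite.\<close>
  next
    case False
    thus ?thesis
      using uv by (auto simp: expected_trace_inv_def ennreal_mult_top)
  qed
qed

theorem lemma1:
  fixes P :: "'a measure"
    and \<Theta> :: "'a \<Rightarrow> real^'k"
    and f\<^sub>\<Theta> :: "real^'k \<Rightarrow> ennreal"
    and G :: "real^'k \<Rightarrow> complex^'m^'t"
    and \<sigma>2 :: real
  assumes "prob_space P"
    and "distributed P lborel \<Theta> f\<^sub>\<Theta>"
    and "AE \<omega> in P. G differentiable (at (\<Theta> \<omega>))"
    and "\<sigma>2 > 0"
  shows "(\<forall>Q1\<in>psd_cone. \<forall>Q2\<in>psd_cone. Q1 \<succeq>\<^sub>L Q2 \<longrightarrow>
            expected_trace_inv P \<Theta> \<sigma>2 G Q1 \<le> expected_trace_inv P \<Theta> \<sigma>2 G Q2) \<and>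
         ennreal_convex_on psd_cone (expected_trace_inv P \<Theta> \<sigma>2 G)"
proof
  show "\<forall>Q1\<in>psd_cone. \<forall>Q2\<in>psd_cone. Q1 \<succeq>\<^sub>L Q2 \<longrightarrow>
            expected_trace_inv P \<Theta> \<sigma>2 G Q1 \<le> expected_trace_inv P \<Theta> \<sigma>2 G Q2"
    using expected_trace_inv_antimono assms(4) by blast
next
  have \<Theta>: "\<Theta> \<in> borel_measurable P"
    using distributed_measurable[OF assms(2)] by simp
  show "ennreal_convex_on psd_cone (expected_trace_inv P \<Theta> \<sigma>2 G)"
    unfolding ennreal_convex_on_def
  proof (intro conjI ballI allI impI)
    fix Q1 Q2 :: "complex^'m^'m" and u v :: real
    assume Q: "Q1 \<in> psd_cone" "Q2 \<in> psd_cone" and uv: "0 \<le> u" "0 \<le> v" "u + v = 1"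
    \<comment> \<open>Zero weights are treated apart because \<open>0 * \<infinity> = 0\<close> in
      \<open>ennreal\<close>; there the inequality is an identity.\<close>
    consider "u = 0" "v = 1" | "u = 1" "v = 0" | "0 < u" "0 < v"
      using uv by linarith
    thus "expected_trace_inv P \<Theta> \<sigma>2 G (u *\<^sub>R Q1 + v *\<^sub>R Q2) \<le>
        ennreal u * expected_trace_inv P \<Theta> \<sigma>2 G Q1 + ennreal v * expected_trace_inv P \<Theta> \<sigma>2 G Q2"
      by cases (simp_all add: expected_trace_inv_convex[OF \<Theta> assms(3,4) Q _ _ uv(3)])
  qed (rule convex_psd_cone)
qed

end
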